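(* Inversion sequences avoiding the pair $(101,021)$ are counted by the integer sequence A106228; that is, for every $n\ge1$, $|\mathbf{I}_n(101,021)|$ equals the coefficient of $t^n$ in the formal power series $A(t)$ determined by $$A(t)=1+\frac{tA(t)}{1-tA(t)^2}.$$ Equivalently, $|\mathbf{I}_n(101,102)|=|\mathbf{I}_n(101,021)|$ for all $n\ge1$.
   Context: An inversion sequence of length $n$ is an integer sequence $e=(e_1,\dots,e_n)$ with $0\le e_i\le i-1$ for all $1\le i\le n$. A word $w_1\cdots w_n$ avoids a pattern $P=p_1\cdots p_k$ if there are no $i_1<\cdots<i_k$ such that $w_{i_1}\cdots w_{i_k}$ is order isomorphic to $P$ (equal letters of $P$ corresponding to equal entries). $\mathbf{I}_n(P_1,\dots,P_r)$ denotes the set of inversion sequences of length $n$ avoiding all of the patterns $P_1,\dots,P_r$. The integer sequence A106228 of the OEIS is $1,1,2,6,21,80,322,1347,5798,25512,\dots$ (starting at index $0$), the coefficient sequence of $A(t)$. *)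

theory Defs
  imports
    "HOL-Library.Sublist"
    "HOL-Computational_Algebra.Formal_Power_Series"
begin

(* Positions are 0-based, so the bound 0 <= e_i <= i - 1 for 1 <= i <= n becomes e ! i <= i for i < n. *)
definition inversion_seqs :: "nat \<Rightarrow> nat list set" where
  "inversion_seqs n = {e. length e = n \<and> (\<forall>i<n. e ! i \<le> i)}"

definition order_isomorphic :: "nat list \<Rightarrow> nat list \<Rightarrow> bool" where
  "order_isomorphic u p \<longleftrightarrow> length u = length p \<and>
     (\<forall>i<length p. \<forall>j<length p.
        (u ! i < u ! j \<longleftrightarrow> p ! i < p ! j) \<and> (u ! i = u ! j \<longleftrightarrow> p ! i = p ! j))"

definition avoids :: "nat list \<Rightarrow> nat list \<Rightarrow> bool" where
  "avoids w p \<longleftrightarrow> \<not> (\<exists>u. subseq u w \<and> order_isomorphic u p)"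

definition inversion_seqs_avoiding :: "nat \<Rightarrow> nat list set \<Rightarrow> nat list set" where
  "inversion_seqs_avoiding n P = {e \<in> inversion_seqs n. \<forall>p\<in>P. avoids e p}"

lemma finite_inversion_seqs_avoiding: "finite (inversion_seqs_avoiding n P)"
proof (rule finite_subset)
  show "inversion_seqs_avoiding n P \<subseteq> {e. set e \<subseteq> {..n} \<and> length e = n}"
    by (force simp: inversion_seqs_avoiding_def inversion_seqs_def in_set_conv_nth)
  show "finite {e. set e \<subseteq> {..n} \<and> length e = n}"
    by (rule finite_lists_length_eq) simp
qed

(* The denominator has constant term 1, so the division is multiplication by its inverse power series. *)
definition A106228_rhs :: "rat fps \<Rightarrow> rat fps" where
  "A106228_rhs A = 1 + fps_X * A / (1 - fps_X * A ^ 2)"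

definition A106228_gf :: "rat fps" where
  "A106228_gf = (THE A. A = A106228_rhs A)"

lemma fps_X_power_dvd_cong: "fps_X ^ n dvd (f - g :: rat fps) \<longleftrightarrow> (\<forall>i<n. fps_nth f i = fps_nth g i)"
proof
  assume "fps_X ^ n dvd f - g"
  then obtain h where h: "f - g = fps_X ^ n * h" by (rule dvdE)
  have "fps_nth (f - g) i = 0" if "i < n" for i using that by (simp add: h fps_X_power_mult_nth)
  then show "\<forall>i<n. fps_nth f i = fps_nth g i" by simp
next
  assume a: "\<forall>i<n. fps_nth f i = fps_nth g i"
  have "f - g = fps_X ^ n * Abs_fps (\<lambda>i. fps_nth (f - g) (i + n))"
    using a by (intro fps_ext) (simp add: fps_X_power_mult_nth)
  then show "fps_X ^ n dvd f - g" by (rule dvdI)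
qed

lemma A106228_rhs_contracts:
  assumes "fps_X ^ n dvd A - B"
  shows "fps_X ^ Suc n dvd A106228_rhs A - A106228_rhs B"
proof -
  define u where "u = inverse (1 - fps_X * A ^ 2)"
  define v where "v = inverse (1 - fps_X * B ^ 2)"
  have u: "(1 - fps_X * A ^ 2) * u = 1" and v: "(1 - fps_X * B ^ 2) * v = 1"
    by (simp_all add: u_def v_def inverse_mult_eq_1')
  have "A * u - B * v = A * u * ((1 - fps_X * B ^ 2) * v) - B * v * ((1 - fps_X * A ^ 2) * u)"
    by (simp add: u v)
  also have "\<dots> = (A - B) * (u * v * (1 + fps_X * A * B))"
    by (simp add: algebra_simps power2_eq_square)
  finally have *: "A * u - B * v = (A - B) * (u * v * (1 + fps_X * A * B))" .
  have "A106228_rhs A - A106228_rhs B = fps_X * (A * u - B * v)"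
    by (simp add: A106228_rhs_def fps_divide_unit algebra_simps flip: u_def v_def)
  then have "A106228_rhs A - A106228_rhs B = fps_X * (A - B) * (u * v * (1 + fps_X * A * B))"
    by (simp only: * mult.assoc)
  then show ?thesis using assms by (auto intro!: dvd_mult2 mult_dvd_mono)
qed

lemma A106228_ex1: "\<exists>!A. A = A106228_rhs A"
proof (rule ex_ex1I)
  define F where "F k = (A106228_rhs ^^ k) 0" for k
  define L where "L = Abs_fps (\<lambda>n. fps_nth (F (Suc n)) n)"
  have step: "fps_X ^ k dvd F (Suc k) - F k" for k
  proof (induction k)
    case (Suc k)
    then show ?case using A106228_rhs_contracts[OF Suc] by (simp add: F_def)
  qed simp
  have "fps_nth (F (Suc n + d)) n = fps_nth L n" for n d
  proof (induction d)
    case (Suc d)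
    have "fps_nth (F (Suc (Suc n + d))) n = fps_nth (F (Suc n + d)) n"
      using step[of "Suc n + d"] unfolding fps_X_power_dvd_cong by simp
    then show ?case using Suc by simp
  qed (simp add: L_def)
  then have FL: "fps_X ^ n dvd F n - L" for n
    unfolding fps_X_power_dvd_cong by (metis less_iff_Suc_add add_Suc)
  have "fps_nth (A106228_rhs L) n = fps_nth L n" for n
  proof -
    have "fps_nth (F (Suc (Suc n))) n = fps_nth (A106228_rhs L) n"
      using A106228_rhs_contracts[OF FL[of "Suc n"]]
      unfolding fps_X_power_dvd_cong by (simp add: F_def)
    moreover have "fps_nth (F (Suc (Suc n))) n = fps_nth L n"
      using FL[of "Suc (Suc n)"] unfolding fps_X_power_dvd_cong by simp
    ultimately show ?thesis by simp
  qed
  then show "\<exists>A. A = A106228_rhs A" by (metis fps_ext)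
next
  fix A B assume A: "A = A106228_rhs A" and B: "B = A106228_rhs B"
  have "fps_X ^ n dvd A - B" for n
  proof (induction n)
    case (Suc n)
    then show ?case using A106228_rhs_contracts[OF Suc] A B by simp
  qed simp
  then show "A = B" unfolding fps_X_power_dvd_cong by (auto intro: fps_ext)
qed

lemma A106228_gf_eq:
  "A106228_gf = 1 + fps_X * A106228_gf / (1 - fps_X * A106228_gf ^ 2)"
  using theI'[OF A106228_ex1, folded A106228_gf_def] by (simp only: A106228_rhs_def[symmetric])

end

theory Submission
  imports Defs
begin

text \<open>
  Both families grow one entry at a time along a generating tree, and in both the number of
  descendants of a sequence depends only on a small label, essentially the slack \<open>d\<close>
  left between the maximum and a length. So the series counting all descendants of a sequence by the
  number of added entries satisfies a linear system indexed by the labels. The point of the proof is that both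
  systems have closed solutions in terms of \<open>A\<close> alone, and that in both the root gets \<open>A\<close>. Clearing
  denominators in the equation for \<open>A\<close> gives \<open>A = 1 + t A r\<close> with \<open>r = 1 - A + A\<^sup>2\<close>, and \<open>r\<close> is what
  governs both solutions.

  Avoiding 101 and 021: append an entry on the right. As the first entry is 0, avoiding 021 means that
  the positive entries increase weakly, and avoiding 101 then means that they increase strictly across
  any zero. With \<open>d\<close> the length minus the maximum, the next entry is 0, or one of the \<open>d\<close> values above
  the maximum, or the maximum again if the last entry is positive. The solution is
  \<open>A r\<^sup>d\<close> after a zero (or at the start) and \<open>A\<^sup>2 r\<^sup>d\<close> after a positive entry: see
  \<open>zero_ended_weight\<close> and \<open>positive_ended_weight\<close>.

  Avoiding 101 and 102: there are no three entries \<open>x, y, z\<close> in this order with \<open>y < x \<le> z\<close>. Appending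
  would require memory of all values used so far, so instead the last occurrence of the maximum is
  removed, or put back. That entry can only play the role of \<open>z\<close>, so it may stand exactly where the
  entries before it increase weakly (\<open>avoids_insert_max\<close>). With \<open>d\<close> the length of the
  initial weakly increasing run minus the maximum, there is one insertion leading to \<open>d + 1\<close>, which
  repeats the maximum, and for each \<open>1 \<le> j \<le> q \<le> d\<close> one insertion of a larger value leading to \<open>j\<close>
  (\<open>max_insertions_eq\<close>). Differencing the system twice leaves a linear recurrence with constant
  coefficients, of characteristic equation \<open>(\<rho> - 1)\<^sup>2 = t \<rho> (\<rho>\<^sup>2 - \<rho> + 1)\<close>. Two of its three roots are
  power series in \<open>\<surd>t\<close>; they have sum \<open>1 + A\<^sup>2\<close> and product \<open>r\<close>, so the solution obeys a recurrence of
  order two over the polynomials in \<open>A\<close> (\<open>slack_weight\<close>, \<open>slack_weight_eq\<close>).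
\<close>

section \<open>Counting by a generating tree\<close>

text \<open>
  \<open>W e\<close> is the series of the descendants of \<open>e\<close> in the tree, counted by their depth below \<open>e\<close>: it counts
  \<open>e\<close> itself and \<open>t\<close> times the descendants of the children. Moving down one level trades one power of \<open>t\<close>,
  so the sum of the coefficients of \<open>t\<^sup>j\<close> over level \<open>m\<close> depends on \<open>m + j\<close> only. The constant terms
  are 1, so at level \<open>n\<close> it is the size of that level.
\<close>

lemma generating_tree_count:
  fixes S :: "nat \<Rightarrow> 'e set" and K :: "'e \<Rightarrow> 'k set" and W :: "'e \<Rightarrow> rat fps"
  assumes seed: "S 0 = {seed}"
    and finite_S: "\<And>n. finite (S n)"
    and finite_K: "\<And>n e. e \<in> S n \<Longrightarrow> finite (K e)"
    and bij: "\<And>n. bij_betw (\<lambda>(e, k). grow e k) (SIGMA e:S n. K e) (S (Suc n))"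
    and W: "\<And>n e. e \<in> S n \<Longrightarrow> W e = 1 + fps_X * (\<Sum>k\<in>K e. W (grow e k))"
  shows "of_nat (card (S n)) = fps_nth (W seed) n"
proof -
  have level: "(\<Sum>e\<in>S m. fps_nth (W e) (Suc j)) = (\<Sum>e\<in>S (Suc m). fps_nth (W e) j)" for m j
  proof -
    have "(\<Sum>e\<in>S m. fps_nth (W e) (Suc j)) = (\<Sum>e\<in>S m. \<Sum>k\<in>K e. fps_nth (W (grow e k)) j)"
      by (rule sum.cong[OF refl], subst W, assumption) (simp add: fps_sum_nth)
    also have "\<dots> = (\<Sum>(e, k)\<in>(SIGMA e:S m. K e). fps_nth (W (grow e k)) j)"
      by (rule sum.Sigma) (auto simp: finite_S finite_K)
    also have "\<dots> = (\<Sum>e\<in>S (Suc m). fps_nth (W e) j)"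
      using sum.reindex_bij_betw[OF bij, of "\<lambda>e. fps_nth (W e) j"] by (simp add: case_prod_unfold)
    finally show ?thesis .
  qed
  have const: "fps_nth (W e) 0 = 1" if "e \<in> S m" for e m
    by (subst W[OF that]) simp
  have "(\<Sum>e\<in>S m. fps_nth (W e) j) = of_nat (card (S (m + j)))" for m j
    by (induction j arbitrary: m) (simp_all add: level const)
  from this[where m = 0 and j = n] show ?thesis by (simp add: seed)
qed

section \<open>The power series\<close>

definition ratio :: "'a::comm_ring_1 \<Rightarrow> 'a" where
  "ratio A = 1 - A + A ^ 2"

text \<open>
  Clearing the denominator turns the defining equation into a cubic, in which the factor \<open>ratio A\<close>
  appears.
\<close>

lemma A106228_gf_cubic:
  "A106228_gf = 1 + fps_X * A106228_gf * ratio A106228_gf"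
proof -
  define A where "A = A106228_gf"
  define u where "u = inverse (1 - fps_X * A ^ 2)"
  have u: "(1 - fps_X * A ^ 2) * u = 1"
    by (simp add: u_def inverse_mult_eq_1')
  have "A = 1 + fps_X * A * u"
    using A106228_gf_eq by (simp add: A_def u_def fps_divide_unit)
  then have "(1 - fps_X * A ^ 2) * A = (1 - fps_X * A ^ 2) + fps_X * A * ((1 - fps_X * A ^ 2) * u)"
    by (metis (no_types, opaque_lifting) distrib_left mult.assoc mult.left_commute mult.right_neutral)
  then show ?thesis
    unfolding u A_def[symmetric] ratio_def by (simp add: algebra_simps power2_eq_square)
qed

text \<open>
  The series of the descendants of a (101, 102)-avoiding sequence of slack \<open>d\<close>. The recurrence is the one
  whose characteristic roots have sum \<open>1 + A\<^sup>2\<close> and product \<open>ratio A\<close>.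
\<close>

fun slack_weight :: "'a::comm_ring_1 \<Rightarrow> nat \<Rightarrow> 'a" where
  "slack_weight A 0 = A"
| "slack_weight A (Suc 0) = A * ratio A"
| "slack_weight A (Suc (Suc d)) = (1 + A ^ 2) * slack_weight A (Suc d) - ratio A * slack_weight A d"

context
  fixes X A :: "'a::comm_ring_1"
  assumes cubic: "A = 1 + X * A * ratio A"
begin

lemma cubic_diff: "X * A * ratio A = A - 1"
  using cubic by (metis add_diff_cancel_left')

text \<open>
  Telescoping: the cubic gives \<open>ratio A - 1 = A (A - 1) = X A\<^sup>2 (ratio A)\<close>.
\<close>

lemma ratio_geometric_sum:
  "X * A ^ 2 * (\<Sum>j=1..d. ratio A ^ j) = ratio A ^ d - 1"
proof -
  have step: "X * A ^ 2 * ratio A = ratio A - 1"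
  proof -
    have "X * A ^ 2 * ratio A = A * (X * A * ratio A)" by (simp add: power2_eq_square)
    also note cubic_diff
    finally show ?thesis by (simp add: ratio_def algebra_simps power2_eq_square)
  qed
  show ?thesis
  proof (induction d)
    case (Suc d)
    have "X * A ^ 2 * (\<Sum>j=1..Suc d. ratio A ^ j)
        = X * A ^ 2 * (\<Sum>j=1..d. ratio A ^ j) + (X * A ^ 2 * ratio A) * ratio A ^ d"
      by (simp add: algebra_simps)
    also have "\<dots> = ratio A ^ Suc d - 1"
      unfolding Suc step by (simp add: algebra_simps)
    finally show ?case .
  qed simp
qed

lemma zero_ended_weight:
  "A * ratio A ^ d = 1 + X * (A * ratio A ^ Suc d + A ^ 2 * (\<Sum>j=1..d. ratio A ^ j))"
proof -
  have "A * ratio A ^ d = (1 + X * A * ratio A) * ratio A ^ d" using cubic by simp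
  with ratio_geometric_sum[of d] show ?thesis by (simp add: algebra_simps)
qed

lemma positive_ended_weight:
  "A ^ 2 * ratio A ^ d = 1 + X * (A * ratio A ^ Suc d + A ^ 2 * (\<Sum>j=1..Suc d. ratio A ^ j))"
proof -
  have "A ^ 2 = ratio A + X * A * ratio A"
    unfolding cubic_diff by (simp add: ratio_def)
  then have "A ^ 2 * ratio A ^ d = (ratio A + X * A * ratio A) * ratio A ^ d" by simp
  with ratio_geometric_sum[of "Suc d"] show ?thesis
    by (simp only: distrib_left mult.assoc[symmetric]) (simp add: algebra_simps)
qed

text \<open>
  Both sides satisfy the recurrence of order two, so it suffices to compare them for two values of \<open>d\<close>.
\<close>

lemma slack_weight_second_difference:
  "slack_weight A (Suc (Suc d)) - 2 * slack_weight A (Suc d) + slack_weight A d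
     = X * (slack_weight A (Suc (Suc (Suc d))) - slack_weight A (Suc (Suc d)) + slack_weight A (Suc d))"
proof (induction d rule: induct_nat_012)
  case 0
  have "X * (slack_weight A (Suc (Suc (Suc 0))) - slack_weight A (Suc (Suc 0)) + slack_weight A (Suc 0))
      = (X * A * ratio A) * (A ^ 2 * A ^ 2 - ratio A + 1)"
    by (simp add: algebra_simps)
  also have "\<dots> = slack_weight A (Suc (Suc 0)) - 2 * slack_weight A (Suc 0) + slack_weight A 0"
    unfolding cubic_diff by (simp add: ratio_def algebra_simps power2_eq_square)
  finally show ?case by (rule sym)
next
  case 1
  have "X * (slack_weight A (Suc (Suc (Suc (Suc 0)))) - slack_weight A (Suc (Suc (Suc 0)))
             + slack_weight A (Suc (Suc 0)))
      = (X * A * ratio A) * A ^ 2 * (A ^ 2 * A ^ 2 + A ^ 2 - 2 * ratio A + 1)"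
    by (simp add: algebra_simps)
  also have "\<dots> = slack_weight A (Suc (Suc (Suc 0))) - 2 * slack_weight A (Suc (Suc 0)) + slack_weight A (Suc 0)"
    unfolding cubic_diff by (simp add: ratio_def algebra_simps power2_eq_square)
  finally show ?case by (rule sym)
next
  case (ge2 d)
  define f where "f d = slack_weight A (Suc (Suc d)) - 2 * slack_weight A (Suc d) + slack_weight A d
     - X * (slack_weight A (Suc (Suc (Suc d))) - slack_weight A (Suc (Suc d)) + slack_weight A (Suc d))" for d
  have rec: "f (Suc (Suc d)) = (1 + A ^ 2) * f (Suc d) - ratio A * f d" for d
    by (simp add: f_def algebra_simps)
  have "f (Suc d) = 0" "f d = 0" using ge2 by (simp_all only: f_def right_minus_eq)
  then have "f (Suc (Suc d)) = 0" by (simp add: rec)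
  then show ?case by (simp only: f_def right_minus_eq)
qed

text \<open>
  The second differences of the two sides agree by the previous lemma; it remains to sum up twice,
  with initial values provided by the cubic.
\<close>

lemma slack_weight_eq:
  "slack_weight A d = 1 + X * (slack_weight A (Suc d) + (\<Sum>q=1..d. \<Sum>j=1..q. slack_weight A j))"
proof -
  have diff: "slack_weight A (Suc d) - slack_weight A d
      = X * (slack_weight A (Suc (Suc d)) - slack_weight A (Suc d) + (\<Sum>j=1..Suc d. slack_weight A j))" for d
  proof (induction d)
    case 0
    have "X * (slack_weight A (Suc (Suc 0)) - slack_weight A (Suc 0) + (\<Sum>j=1..Suc 0. slack_weight A j))
        = (X * A * ratio A) * A ^ 2"
      by (simp add: algebra_simps)
    also have "\<dots> = slack_weight A (Suc 0) - slack_weight A 0"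
      unfolding cubic_diff by (simp add: ratio_def algebra_simps power2_eq_square)
    finally show ?case by (rule sym)
  next
    case (Suc d)
    have "slack_weight A (Suc (Suc d)) - slack_weight A (Suc d)
        = (slack_weight A (Suc (Suc d)) - 2 * slack_weight A (Suc d) + slack_weight A d)
          + (slack_weight A (Suc d) - slack_weight A d)"
      by (simp del: slack_weight.simps)
    also have "\<dots> = X * (slack_weight A (Suc (Suc (Suc d))) - slack_weight A (Suc (Suc d))
          + (\<Sum>j=1..Suc (Suc d). slack_weight A j))"
      unfolding Suc slack_weight_second_difference[of d]
      by (simp add: algebra_simps del: slack_weight.simps)
    finally show ?case .
  qed
  show ?thesis
  proof (induction d)
    case 0
    show ?case using cubic_diff by (simp add: mult.assoc)
  next
    case (Suc d)
    have "slack_weight A (Suc d) = slack_weight A d + (slack_weight A (Suc d) - slack_weight A d)" by simp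
    also have "\<dots> = 1 + X * (slack_weight A (Suc (Suc d)) + (\<Sum>q=1..Suc d. \<Sum>j=1..q. slack_weight A j))"
      unfolding diff[of d] by (subst Suc) (simp add: algebra_simps del: slack_weight.simps)
    finally show ?case .
  qed
qed

end

section \<open>Patterns of length three\<close>

lemma avoids_length3:
  "avoids w [a, b, c] \<longleftrightarrow>
     \<not> (\<exists>x y z. subseq [x, y, z] w \<and> order_isomorphic [x, y, z] [a, b, c])"
proof -
  have "\<exists>x y z. u = [x, y, z]" if "order_isomorphic u [a, b, c]" for u
    using that by (auto simp: order_isomorphic_def length_Suc_conv)
  then show ?thesis unfolding avoids_def by metis
qed

lemma avoids_101: "avoids w [1, 0, 1] \<longleftrightarrow> (\<forall>x y z. subseq [x, y, z] w \<longrightarrow> \<not> (y < x \<and> x = z))"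
proof -
  have "order_isomorphic [x, y, z] [1, 0, 1] \<longleftrightarrow> y < x \<and> x = z" for x y z
    by (auto simp: order_isomorphic_def All_less_Suc)
  then show ?thesis by (simp only: avoids_length3) blast
qed

lemma avoids_102: "avoids w [1, 0, 2] \<longleftrightarrow> (\<forall>x y z. subseq [x, y, z] w \<longrightarrow> \<not> (y < x \<and> x < z))"
proof -
  have "order_isomorphic [x, y, z] [1, 0, 2] \<longleftrightarrow> y < x \<and> x < z" for x y z
    by (auto simp: order_isomorphic_def All_less_Suc)
  then show ?thesis by (simp only: avoids_length3) blast
qed

lemma avoids_021: "avoids w [0, 2, 1] \<longleftrightarrow> (\<forall>x y z. subseq [x, y, z] w \<longrightarrow> \<not> (x < z \<and> z < y))"
proof -
  have "order_isomorphic [x, y, z] [0, 2, 1] \<longleftrightarrow> x < z \<and> z < y" for x y z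
    by (auto simp: order_isomorphic_def All_less_Suc)
  then show ?thesis by (simp only: avoids_length3) blast
qed

lemma split_Cons_iff:
  "(\<exists>as bs. x # xs = as @ bs \<and> P as bs) \<longleftrightarrow> P [] (x # xs) \<or> (\<exists>as bs. xs = as @ bs \<and> P (x # as) bs)"
  by (auto simp: Cons_eq_append_conv)

lemma subseq2_append:
  "subseq [x, y] (us @ vs) \<longleftrightarrow>
     subseq [x, y] us \<or> x \<in> set us \<and> y \<in> set vs \<or> subseq [x, y] vs"
  by (auto simp: subseq_append_iff split_Cons_iff subseq_singleton_left)

lemma subseq3_append:
  "subseq [x, y, z] (us @ vs) \<longleftrightarrow>
     subseq [x, y, z] us \<or> subseq [x, y] us \<and> z \<in> set vs \<or>
     x \<in> set us \<and> subseq [y, z] vs \<or> subseq [x, y, z] vs"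
  by (auto simp: subseq_append_iff split_Cons_iff subseq_singleton_left)

lemma subseq3_snoc:
  "subseq [x, y, z] (us @ [a]) \<longleftrightarrow> subseq [x, y, z] us \<or> subseq [x, y] us \<and> z = a"
  by (auto simp: subseq3_append)

lemma subseq2_in_set: "subseq [x, y] us \<Longrightarrow> x \<in> set us \<and> y \<in> set us"
  by (induction us) (auto simp: subseq_singleton_left split: if_splits)

lemma sorted_iff_subseq2: "sorted us \<longleftrightarrow> (\<forall>x y. subseq [x, y] us \<longrightarrow> x \<le> y)"
proof (induction us)
  case (Cons a us)
  have "subseq [x, y] (a # us) \<longleftrightarrow> x = a \<and> y \<in> set us \<or> subseq [x, y] us" for x y
    using subseq2_append[of x y "[a]" us] by simp
  then show ?case using Cons by auto
qed simp

section \<open>Inversion sequences\<close>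

definition max_entry :: "nat list \<Rightarrow> nat" where
  "max_entry e = Max (insert 0 (set e))"

lemma entry_le_max_entry: "x \<in> set e \<Longrightarrow> x \<le> max_entry e"
  by (simp add: max_entry_def)

lemma max_entry_in_set: "max_entry e > 0 \<Longrightarrow> max_entry e \<in> set e"
  using Max_in[of "insert 0 (set e)"] by (auto simp: max_entry_def)

lemma max_entry_Nil [simp]: "max_entry [] = 0"
  by (simp add: max_entry_def)

lemma max_entry_eqI:
  assumes "m \<in> set e" "\<And>x. x \<in> set e \<Longrightarrow> x \<le> m"
  shows "max_entry e = m"
  unfolding max_entry_def using assms by (intro Max_eqI) auto

lemma max_entry_snoc [simp]: "max_entry (e @ [x]) = max (max_entry e) x"
proof -
  have "insert 0 (set (e @ [x])) = insert x (insert 0 (set e))" by auto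
  then have "max_entry (e @ [x]) = Max (insert x (insert 0 (set e)))"
    by (simp only: max_entry_def)
  also have "\<dots> = max x (max_entry e)" unfolding max_entry_def by (rule Max_insert) auto
  finally show ?thesis by (simp add: max.commute)
qed

lemma inversion_seqs_0 [simp]: "inversion_seqs 0 = {[]}"
  by (auto simp: inversion_seqs_def)

lemma inversion_seqs_length: "e \<in> inversion_seqs n \<Longrightarrow> length e = n"
  by (simp add: inversion_seqs_def)

lemma snoc_mem_inversion_seqs:
  "e @ [x] \<in> inversion_seqs (Suc n) \<longleftrightarrow> e \<in> inversion_seqs n \<and> x \<le> n"
  by (auto simp: inversion_seqs_def nth_append less_Suc_eq)

lemma hd_inversion_seq:
  assumes "e \<in> inversion_seqs n" "e \<noteq> []"
  obtains e' where "e = 0 # e'"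
  using assms by (cases e) (auto simp: inversion_seqs_def)

lemma max_entry_le:
  assumes "e \<in> inversion_seqs n" shows "max_entry e \<le> n"
proof -
  have "x \<le> n" if "x \<in> set e" for x
    using that assms unfolding inversion_seqs_def in_set_conv_nth
    by (metis (mono_tags, lifting) le_trans less_imp_le mem_Collect_eq)
  then show ?thesis by (simp add: max_entry_def)
qed

text \<open>
  Entries \<open>x\<close> above the current maximum \<open>M\<close> are enumerated by the slack \<open>L + 1 - x\<close> that they produce.
\<close>

lemma sum_gap_reindex:
  "(\<Sum>x\<in>{M<..L}. f (Suc L - x)) = (\<Sum>j=1..L - M. f j)" for L M :: nat
  by (rule sum.reindex_bij_witness[of _ "\<lambda>j. Suc L - j" "\<lambda>x. Suc L - x"]) auto

section \<open>Inversion sequences avoiding 101 and 021\<close>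

definition next_letters :: "nat list \<Rightarrow> nat set" where
  "next_letters e = {x. x \<le> length e \<and>
     (x = 0 \<or> max_entry e < x \<or> x = max_entry e \<and> e \<noteq> [] \<and> last e \<noteq> 0)}"

lemma mem_avoiding_101_021:
  "e \<in> inversion_seqs_avoiding n {[1,0,1], [0,2,1]} \<longleftrightarrow>
     e \<in> inversion_seqs n \<and>
     (\<forall>x y z. subseq [x, y, z] e \<longrightarrow> \<not> (y < x \<and> x = z) \<and> \<not> (x < z \<and> z < y))"
  unfolding inversion_seqs_avoiding_def mem_Collect_eq ball_simps avoids_101 avoids_021
  by blast

text \<open>
  A new last entry \<open>x\<close> can only be the last letter of a pattern. If \<open>0 < x < M\<close> for the maximum \<open>M\<close>, the
  first entry 0, then \<open>M\<close>, then \<open>x\<close> form 021. If \<open>x = M > 0\<close> comes after a zero, \<open>M, 0, M\<close> form 101.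
  Conversely, if \<open>x = M\<close> comes after a positive last entry \<open>y\<close>, then \<open>y = M\<close>, as otherwise \<open>0, M, y\<close> would form
  021; so a pattern ending in \<open>x\<close> would already end in \<open>y\<close>.
\<close>

lemma snoc_avoids_101_021:
  assumes e: "e \<in> inversion_seqs_avoiding n {[1,0,1], [0,2,1]}"
  shows "e @ [x] \<in> inversion_seqs_avoiding (Suc n) {[1,0,1], [0,2,1]} \<longleftrightarrow> x \<in> next_letters e"
proof -
  have inv: "e \<in> inversion_seqs n" and len: "length e = n"
    and a101: "\<And>x y. subseq [x, y, x] e \<Longrightarrow> \<not> y < x"
    and a021: "\<And>x y z. subseq [x, y, z] e \<Longrightarrow> \<not> (x < z \<and> z < y)"
    using e unfolding mem_avoiding_101_021 by (auto simp: inversion_seqs_length)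
  have "e @ [x] \<in> inversion_seqs_avoiding (Suc n) {[1,0,1], [0,2,1]} \<longleftrightarrow>
      x \<le> n \<and> (\<forall>a b. subseq [a, b] e \<longrightarrow> \<not> (b < a \<and> a = x) \<and> \<not> (a < x \<and> x < b))"
    using e unfolding mem_avoiding_101_021 snoc_mem_inversion_seqs subseq3_snoc by blast
  also have "\<dots> \<longleftrightarrow> x \<in> next_letters e"
  proof (intro iffI)
    assume x: "x \<le> n \<and> (\<forall>a b. subseq [a, b] e \<longrightarrow> \<not> (b < a \<and> a = x) \<and> \<not> (a < x \<and> x < b))"
    show "x \<in> next_letters e"
    proof (cases "0 < x \<and> x \<le> max_entry e")
      case True
      then have M: "max_entry e \<in> set e" by (intro max_entry_in_set) simp
      then have "e \<noteq> []" by auto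
      then obtain e' where e': "e = 0 # e'" using hd_inversion_seq[OF inv] by blast
      have "subseq [0, max_entry e] e"
        using M True by (auto simp: e' subseq_singleton_left)
      with x True have eq: "x = max_entry e" by (metis le_neq_implies_less)
      have "last e \<noteq> 0"
      proof
        assume "last e = 0"
        then obtain e1 where split: "e = e1 @ [0]"
          using \<open>e \<noteq> []\<close> by (metis append_butlast_last_id)
        with M True have "max_entry e \<in> set e1" by auto
        then have "subseq [max_entry e, 0] e" by (subst split) (simp add: subseq2_append)
        with x True eq show False by blast
      qed
      with eq x len \<open>e \<noteq> []\<close> show ?thesis by (simp add: next_letters_def)
    qed (use x len in \<open>auto simp: next_letters_def\<close>)
  next
    assume x: "x \<in> next_letters e"
    have "False" if ab: "subseq [a, b] e" and bad: "b < a \<and> a = x \<or> a < x \<and> x < b" for a b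
    proof -
      have "a \<le> max_entry e" "b \<le> max_entry e"
        using subseq2_in_set[OF ab] by (auto intro: entry_le_max_entry)
      then have eq: "x = max_entry e" and ne: "e \<noteq> []" "last e \<noteq> 0" and ba: "b < a" "a = x"
        using x bad by (auto simp: next_letters_def)
      obtain e1 y where split: "e = e1 @ [y]" using ne by (metis append_butlast_last_id)
      have y: "0 < y" "y \<le> x" using ne eq by (auto simp: split)
      have "y = x"
      proof (rule ccontr)
        assume "y \<noteq> x"
        with y have less: "y < x" by simp
        have "x \<in> set e1" using subseq2_in_set[OF ab] ba less by (auto simp: split)
        moreover obtain e' where "e = 0 # e'" using hd_inversion_seq[OF inv] ne by blast
        with \<open>x \<in> set e1\<close> obtain e1' where "e1 = 0 # e1'"
          by (auto simp: split append_eq_Cons_conv)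
        ultimately have "subseq [0, x] e1" using less by (auto simp: subseq_singleton_left)
        then have "subseq [0, x, y] e" by (simp add: split subseq3_append)
        with a021 less y show False by blast
      qed
      moreover from this have "subseq [a, b] e1"
        using ab ba by (auto simp: split subseq2_append subseq_singleton_left dest: subseq_Cons')
      ultimately have "subseq [a, b, a] e"
        using ba by (simp add: split subseq3_append)
      with a101 ba show False by blast
    qed
    with x len show "x \<le> n \<and> (\<forall>a b. subseq [a, b] e \<longrightarrow> \<not> (b < a \<and> a = x) \<and> \<not> (a < x \<and> x < b))"
      by (auto simp: next_letters_def)
  qed
  finally show ?thesis .
qed

lemma card_avoiding_101_021:
  "of_nat (card (inversion_seqs_avoiding n {[1,0,1], [0,2,1]})) = fps_nth A106228_gf n"
proof -
  define A where "A = A106228_gf"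
  have cubic: "A = 1 + fps_X * A * ratio A"
    unfolding A_def by (rule A106228_gf_cubic)
  define S where "S n = inversion_seqs_avoiding n {[1,0,1], [0,2,1]}" for n
  define W where "W e = (if e \<noteq> [] \<and> last e \<noteq> 0 then A ^ 2 else A) * ratio A ^ (length e - max_entry e)"
    for e :: "nat list"
  have "of_nat (card (S n)) = fps_nth (W []) n"
  proof (rule generating_tree_count[where K = next_letters and grow = "\<lambda>e x. e @ [x]"])
    show "S 0 = {[]}"
      unfolding S_def by (auto simp: set_eq_iff simp del: One_nat_def simp: mem_avoiding_101_021)
    show "finite (S n)" for n by (simp add: S_def finite_inversion_seqs_avoiding)
    show "finite (next_letters e)" for e by (simp add: next_letters_def)
    show "bij_betw (\<lambda>(e, x). e @ [x]) (SIGMA e:S n. next_letters e) (S (Suc n))" for n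
    proof (rule bij_betw_imageI)
      show "inj_on (\<lambda>(e, x). e @ [x]) (SIGMA e:S n. next_letters e)" by (auto simp: inj_on_def)
      show "(\<lambda>(e, x). e @ [x]) ` (SIGMA e:S n. next_letters e) = S (Suc n)"
      proof (intro equalityI subsetI)
        fix e assume e: "e \<in> S (Suc n)"
        then have "length e = Suc n"
          by (auto simp: S_def inversion_seqs_avoiding_def inversion_seqs_def)
        then obtain e' x where eq: "e = e' @ [x]" by (metis length_Suc_conv_rev)
        have "e' \<in> S n"
          using e unfolding S_def eq mem_avoiding_101_021 snoc_mem_inversion_seqs subseq3_snoc
          by blast
        with e snoc_avoids_101_021[of e' n x] show "e \<in> (\<lambda>(e, x). e @ [x]) ` (SIGMA e:S n. next_letters e)"
          by (auto simp: S_def eq simp del: One_nat_def)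
      qed (auto simp: S_def snoc_avoids_101_021 simp del: One_nat_def)
    qed
    show "W e = 1 + fps_X * (\<Sum>x\<in>next_letters e. W (e @ [x]))" if "e \<in> S n" for e n
    proof -
      define M where "M = max_entry e"
      define L where "L = length e"
      have M_le: "M \<le> L" using that max_entry_le[of e n]
        by (auto simp: S_def M_def L_def inversion_seqs_avoiding_def inversion_seqs_length)
      have zero: "W (e @ [0]) = A * ratio A ^ Suc (L - M)"
        using M_le by (simp add: W_def M_def L_def Suc_diff_le)
      have "(\<Sum>x\<in>{M<..L}. W (e @ [x])) = (\<Sum>x\<in>{M<..L}. A ^ 2 * ratio A ^ (Suc L - x))"
        by (rule sum.cong) (auto simp: W_def M_def L_def max_def)
      also have "\<dots> = A ^ 2 * (\<Sum>j=1..L - M. ratio A ^ j)"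
        by (simp add: sum_gap_reindex sum_distrib_left[symmetric])
      finally have above: "(\<Sum>x\<in>{M<..L}. W (e @ [x])) = A ^ 2 * (\<Sum>j=1..L - M. ratio A ^ j)" .
      show ?thesis
      proof (cases "e \<noteq> [] \<and> last e \<noteq> 0")
        case True
        then have "last e \<le> M" by (simp add: M_def entry_le_max_entry)
        with True have M0: "0 < M" by simp
        have K: "next_letters e = insert 0 (insert M {M<..L})"
          using True M_le by (auto simp: next_letters_def M_def L_def)
        have eqM: "W (e @ [M]) = A ^ 2 * ratio A ^ Suc (L - M)"
          using M0 M_le by (simp add: W_def M_def L_def Suc_diff_le)
        have "(\<Sum>x\<in>next_letters e. W (e @ [x]))
            = A * ratio A ^ Suc (L - M) + A ^ 2 * (\<Sum>j=1..Suc (L - M). ratio A ^ j)"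
          unfolding K using M0 zero eqM above by (simp add: algebra_simps)
        then show ?thesis
          using positive_ended_weight[OF cubic, of "L - M"] True
          by (simp add: W_def M_def L_def)
      next
        case False
        have K: "next_letters e = insert 0 {M<..L}"
          using False M_le by (auto simp: next_letters_def M_def L_def)
        have "(\<Sum>x\<in>next_letters e. W (e @ [x]))
            = A * ratio A ^ Suc (L - M) + A ^ 2 * (\<Sum>j=1..L - M. ratio A ^ j)"
          unfolding K using zero above by simp
        then show ?thesis
          using zero_ended_weight[OF cubic, of "L - M"] False
          by (auto simp add: W_def M_def L_def)
      qed
    qed
  qed
  then show ?thesis by (simp add: W_def S_def A_def)
qed

section \<open>Inversion sequences avoiding 101 and 102\<close>

definition avoids_101_102 :: "nat list \<Rightarrow> bool" where
  "avoids_101_102 e \<longleftrightarrow> (\<forall>x y z. subseq [x, y, z] e \<longrightarrow> \<not> (y < x \<and> x \<le> z))"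

lemma mem_avoiding_101_102:
  "e \<in> inversion_seqs_avoiding n {[1,0,1], [1,0,2]} \<longleftrightarrow> e \<in> inversion_seqs n \<and> avoids_101_102 e"
  unfolding inversion_seqs_avoiding_def mem_Collect_eq ball_simps avoids_101 avoids_102
    avoids_101_102_def le_less
  by blast

text \<open>
  The inserted \<open>m\<close> cannot be the small middle letter \<open>y\<close>, since nothing exceeds it, nor the letter \<open>x\<close>,
  since everything after it is smaller. As the letter \<open>z\<close> it forbids every descent before it.
\<close>

lemma avoids_insert_max:
  assumes us: "\<forall>x\<in>set us. x \<le> m" and vs: "\<forall>x\<in>set vs. x < m"
  shows "avoids_101_102 (us @ m # vs) \<longleftrightarrow> avoids_101_102 (us @ vs) \<and> sorted us"
proof (intro iffI conjI)
  assume whole: "avoids_101_102 (us @ m # vs)"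
  have "subseq (us @ vs) (us @ m # vs)" by (simp add: subseq_append' list_emb_Cons)
  with whole show "avoids_101_102 (us @ vs)"
    unfolding avoids_101_102_def by (meson subseq_order.trans)
  show "sorted us" unfolding sorted_iff_subseq2
  proof (intro allI impI)
    fix x y assume xy: "subseq [x, y] us"
    then have "subseq [x, y, m] (us @ m # vs)" by (simp add: subseq3_append)
    moreover have "x \<le> m" using subseq2_in_set[OF xy] us by blast
    ultimately show "x \<le> y" using whole unfolding avoids_101_102_def by (meson not_less)
  qed
next
  assume parts: "avoids_101_102 (us @ vs) \<and> sorted us"
  show "avoids_101_102 (us @ m # vs)" unfolding avoids_101_102_def
  proof (intro allI impI notI)
    fix x y z assume sub: "subseq [x, y, z] (us @ m # vs)" and bad: "y < x \<and> x \<le> z"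
    have "\<not> subseq [x, y] us" using parts bad unfolding sorted_iff_subseq2 by (meson not_less)
    moreover have "\<not> subseq [x, y, z] (us @ vs)"
      using parts bad unfolding avoids_101_102_def by blast
    ultimately have "x \<in> set us \<and> y = m \<or> x = m \<and> subseq [y, z] vs"
      using sub by (auto simp: subseq3_append subseq_singleton_left split: if_splits)
    then show False
      using us vs bad subseq2_in_set[of y z vs] by fastforce
  qed
qed

definition initial_run :: "nat list \<Rightarrow> nat" where
  "initial_run e = Max {p. p \<le> length e \<and> sorted (take p e)}"

text \<open>
  A prefix of a sorted prefix is sorted, so the sorted prefixes are those up to the longest one.
\<close>

lemma initial_run_le: "initial_run e \<le> length e"
  and sorted_take_iff: "p \<le> length e \<Longrightarrow> sorted (take p e) \<longleftrightarrow> p \<le> initial_run e"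
proof -
  let ?R = "{p. p \<le> length e \<and> sorted (take p e)}"
  have fin: "finite ?R" by simp
  have "0 \<in> ?R" by simp
  then have run: "initial_run e \<in> ?R"
    unfolding initial_run_def using Max_in[OF fin] by blast
  then show "initial_run e \<le> length e" by simp
  assume p: "p \<le> length e"
  show "sorted (take p e) \<longleftrightarrow> p \<le> initial_run e"
  proof
    assume "sorted (take p e)"
    with p show "p \<le> initial_run e" unfolding initial_run_def by (intro Max_ge[OF fin]) simp
  next
    assume "p \<le> initial_run e"
    then have "take p e = take p (take (initial_run e) e)" by (simp add: min_absorb1)
    with run show "sorted (take p e)" using sorted_wrt_take[of _ "take (initial_run e) e" p] by simp
  qed
qed

lemma initial_run_insert_max:
  assumes "sorted us" "\<forall>x\<in>set us. x \<le> m" "\<forall>x\<in>set vs. x < m"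
  shows "initial_run (us @ m # vs) = Suc (length us)"
proof (rule antisym)
  let ?e = "us @ m # vs"
  have "sorted (take (Suc (length us)) ?e)" using assms by (simp add: sorted_append)
  then show "Suc (length us) \<le> initial_run ?e" by (subst (asm) sorted_take_iff) auto
  show "initial_run ?e \<le> Suc (length us)"
  proof (cases vs)
    case Nil
    then show ?thesis using initial_run_le[of ?e] by simp
  next
    case (Cons v vs')
    then have "\<not> sorted (take (Suc (Suc (length us))) ?e)" using assms by (simp add: sorted_append)
    then show ?thesis using Cons by (subst (asm) sorted_take_iff) auto
  qed
qed

text \<open>
  Shifting entries to the right preserves the bounds. When they are shifted back to the left, the entries after
  \<open>m\<close> still obey the bounds because they are smaller than \<open>m\<close>, which is at most its own position.
\<close>

lemma insert_mem_inversion_seqs: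
  assumes "\<forall>x\<in>set vs. x < m"
  shows "us @ m # vs \<in> inversion_seqs (Suc n) \<longleftrightarrow> us @ vs \<in> inversion_seqs n \<and> m \<le> length us"
proof -
  have "(\<forall>i<Suc (length us + length vs). (us @ m # vs) ! i \<le> i) \<longleftrightarrow>
      (\<forall>i<length us + length vs. (us @ vs) ! i \<le> i) \<and> m \<le> length us" (is "?L \<longleftrightarrow> ?R")
  proof
    assume L: ?L
    then have m: "m \<le> length us" by (metis le_add1 less_Suc_eq_le nth_append_length)
    have "(us @ vs) ! i \<le> i" if i: "i < length us + length vs" for i
    proof (cases "i < length us")
      case True
      then show ?thesis using L[rule_format, of i] by (simp add: nth_append)
    next
      case False
      then have "vs ! (i - length us) < m" using assms i by (simp add: nth_mem)
      then show ?thesis using False m by (simp add: nth_append)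
    qed
    with m show ?R by blast
  next
    assume R: ?R
    have "(us @ m # vs) ! i \<le> i" if i: "i < Suc (length us + length vs)" for i
    proof (cases "i \<le> length us")
      case True
      then show ?thesis using R[THEN conjunct1, rule_format, of i] R i
        by (cases "i = length us") (auto simp: nth_append)
    next
      case False
      then obtain j where j: "i = Suc j" "length us \<le> j" by (cases i) auto
      then show ?thesis using R[THEN conjunct1, rule_format, of j] i
        by (simp add: nth_append Suc_diff_le)
    qed
    then show ?L by blast
  qed
  then show ?thesis by (auto simp: inversion_seqs_def)
qed

lemma last_max_split:
  assumes "e \<noteq> []"
  obtains us vs where "e = us @ max_entry e # vs"
    "\<forall>x\<in>set us. x \<le> max_entry e" "\<forall>x\<in>set vs. x < max_entry e"
proof -
  have "max_entry e \<in> set e"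
  proof (cases "max_entry e > 0")
    case False
    then have "hd e = max_entry e" using entry_le_max_entry[of "hd e" e] assms by simp
    then show ?thesis using assms by (metis hd_in_set)
  qed (rule max_entry_in_set)
  then obtain us vs where split: "e = us @ max_entry e # vs" "max_entry e \<notin> set vs"
    by (metis split_list_last)
  have "x \<le> max_entry e" if "x \<in> set us \<union> set vs" for x
    using that split(1) by (intro entry_le_max_entry) (metis Un_iff list.set_intros(2) set_append)
  then show thesis using that split by (metis UnCI le_neq_implies_less)
qed

text \<open>
  For an avoiding inversion sequence \<open>e\<close>: the pairs of a position \<open>p\<close> and a value \<open>m\<close> such that inserting \<open>m\<close> at \<open>p\<close> yields an avoiding inversion
  sequence in which this entry is the last occurrence of the maximum.
\<close>

definition max_insertions :: "nat list \<Rightarrow> (nat \<times> nat) set" where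
  "max_insertions e = {(p, m). m \<le> p \<and> p \<le> length e \<and> sorted (take p e) \<and>
     (\<forall>x\<in>set (take p e). x \<le> m) \<and> (\<forall>x\<in>set (drop p e). x < m)}"

text \<open>
  A value above the maximum \<open>M\<close> may go anywhere in the initial run, subject to the bound \<open>m \<le> p\<close>. A further
  copy of \<open>M\<close> must go behind all others, and there is exactly one place: up to its last occurrence \<open>M\<close>
  is preceded by a sorted prefix and what follows is smaller, so the initial run ends with that occurrence.
\<close>

lemma max_insertions_eq:
  assumes e: "e \<in> inversion_seqs n" "avoids_101_102 e"
  shows "max_entry e \<le> initial_run e"
    and "max_insertions e = insert (initial_run e, max_entry e)
      (SIGMA p:{max_entry e<..initial_run e}. {max_entry e<..p})"
proof -
  define M where "M = max_entry e"
  define l where "l = initial_run e"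
  have top: "x \<le> M" if "x \<in> set e" for x using that by (simp add: M_def entry_le_max_entry)
  have main: "M \<le> l \<and> (\<forall>x\<in>set (drop l e). x < M) \<and> (\<forall>p<l. M \<in> set (drop p e))"
  proof (cases "e = []")
    case True
    then show ?thesis using initial_run_le[of e] by (simp add: M_def l_def)
  next
    case False
    then obtain us vs where split: "e = us @ M # vs"
      and us: "\<forall>x\<in>set us. x \<le> M" and vs: "\<forall>x\<in>set vs. x < M"
      unfolding M_def by (rule last_max_split)
    have "sorted us" using e(2) avoids_insert_max[OF us vs] by (simp add: split)
    then have l: "l = Suc (length us)"
      using initial_run_insert_max[OF _ us vs] by (simp add: l_def split)
    have "n = Suc (length us + length vs)" using inversion_seqs_length[OF e(1)] by (simp add: split)
    then have "M \<le> length us" using e(1) insert_mem_inversion_seqs[OF vs] by (simp add: split)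
    moreover have "M \<in> set (drop p e)" if "p < l" for p
      using that by (simp add: split l)
    ultimately show ?thesis using vs by (simp add: l split)
  qed
  then show "max_entry e \<le> initial_run e" by (simp add: M_def l_def)
  have "(p, m) \<in> max_insertions e \<longleftrightarrow>
      p = l \<and> m = M \<or> M < m \<and> m \<le> p \<and> p \<le> l" for p m
  proof
    assume "(p, m) \<in> max_insertions e"
    then have p: "m \<le> p" "p \<le> l" and le: "\<forall>x\<in>set (take p e). x \<le> m"
      and less: "\<forall>x\<in>set (drop p e). x < m"
      using sorted_take_iff[of p e] by (auto simp: max_insertions_def l_def)
    have "x \<le> m" if "x \<in> set e" for x
    proof -
      have "x \<in> set (take p e @ drop p e)" using that by simp
      with le less show ?thesis unfolding set_append by fastforce
    qed
    then have "M \<le> m" by (simp add: M_def max_entry_def)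
    moreover have "p = l" if "m = M" using main p less that by (metis le_neq_implies_less less_irrefl)
    ultimately show "p = l \<and> m = M \<or> M < m \<and> m \<le> p \<and> p \<le> l" using p by auto
  next
    assume pm: "p = l \<and> m = M \<or> M < m \<and> m \<le> p \<and> p \<le> l"
    have len: "p \<le> length e" using pm initial_run_le[of e] by (auto simp: l_def)
    moreover have "sorted (take p e)" using pm len by (auto simp: sorted_take_iff l_def)
    moreover have "\<forall>x\<in>set (take p e). x \<le> m" using pm top by (fastforce dest: in_set_takeD)
    moreover have "\<forall>x\<in>set (drop p e). x < m" using pm top main by (fastforce dest: in_set_dropD)
    ultimately show "(p, m) \<in> max_insertions e" using pm main by (auto simp: max_insertions_def)
  qed
  then show "max_insertions e = insert (initial_run e, max_entry e)
      (SIGMA p:{max_entry e<..initial_run e}. {max_entry e<..p})"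
    unfolding M_def l_def by (auto simp: set_eq_iff)
qed

definition insert_at :: "nat list \<Rightarrow> nat \<times> nat \<Rightarrow> nat list" where
  "insert_at e = (\<lambda>(p, m). take p e @ m # drop p e)"

lemma max_insertion_stats:
  assumes "(p, m) \<in> max_insertions e"
  shows "max_entry (insert_at e (p, m)) = m" and "initial_run (insert_at e (p, m)) = Suc p"
proof -
  show "max_entry (insert_at e (p, m)) = m"
    using assms by (intro max_entry_eqI) (auto simp: insert_at_def max_insertions_def intro: less_imp_le)
  show "initial_run (insert_at e (p, m)) = Suc p"
    using assms by (auto simp: insert_at_def max_insertions_def initial_run_insert_max)
qed

text \<open>
  Maximum and initial run of the new sequence reveal \<open>m\<close> and \<open>p\<close>, hence the parent. Conversely every nonempty
  avoiding sequence arises by splitting it at the last occurrence of its maximum.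
\<close>

lemma bij_betw_insert_max:
  fixes n :: nat
  defines "S \<equiv> \<lambda>n. inversion_seqs_avoiding n {[1,0,1], [1,0,2]}"
  shows "bij_betw (\<lambda>(e, k). insert_at e k) (SIGMA e:S n. max_insertions e) (S (Suc n))"
proof (rule bij_betw_imageI)
  show "inj_on (\<lambda>(e, k). insert_at e k) (SIGMA e:S n. max_insertions e)"
  proof (rule inj_onI, clarify)
    fix e p m e' p' m'
    assume k: "(p, m) \<in> max_insertions e" and k': "(p', m') \<in> max_insertions e'"
      and eq: "insert_at e (p, m) = insert_at e' (p', m')"
    have m: "m = m'" and p: "p = p'"
      using max_insertion_stats[OF k] max_insertion_stats[OF k'] by (simp_all add: eq)
    have "length (take p e) = length (take p' e')"
      using k k' p by (simp add: max_insertions_def)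
    then have "take p e = take p e'" "drop p e = drop p e'"
      using eq by (auto simp: insert_at_def p)
    then have "e = e'" by (metis append_take_drop_id)
    with m p show "e = e' \<and> (p, m) = (p', m')" by simp
  qed
  show "(\<lambda>(e, k). insert_at e k) ` (SIGMA e:S n. max_insertions e) = S (Suc n)"
  proof (intro equalityI subsetI)
    fix f assume "f \<in> (\<lambda>(e, k). insert_at e k) ` (SIGMA e:S n. max_insertions e)"
    then obtain e p m where e: "e \<in> S n" and k: "(p, m) \<in> max_insertions e"
      and f: "f = take p e @ m # drop p e"
      by (auto simp: insert_at_def)
    from k have bounds: "\<forall>x\<in>set (take p e). x \<le> m" "\<forall>x\<in>set (drop p e). x < m"
      and rest: "sorted (take p e)" "m \<le> length (take p e)"
      by (auto simp: max_insertions_def)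
    with e show "f \<in> S (Suc n)"
      unfolding S_def mem_avoiding_101_102 f avoids_insert_max[OF bounds]
        insert_mem_inversion_seqs[OF bounds(2)] by simp
  next
    fix f assume f: "f \<in> S (Suc n)"
    then have inv: "f \<in> inversion_seqs (Suc n)" and av: "avoids_101_102 f"
      by (simp_all only: S_def mem_avoiding_101_102)
    from inv have "f \<noteq> []" by (auto simp: inversion_seqs_def)
    then obtain us m vs where split: "f = us @ m # vs"
      and bounds: "\<forall>x\<in>set us. x \<le> m" "\<forall>x\<in>set vs. x < m"
      by (metis last_max_split)
    have "us @ vs \<in> S n" "sorted us" "m \<le> length us"
      using inv av unfolding S_def mem_avoiding_101_102 split avoids_insert_max[OF bounds]
        insert_mem_inversion_seqs[OF bounds(2)] by simp_all
    then have "(us @ vs, (length us, m)) \<in> (SIGMA e:S n. max_insertions e)"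
      using bounds by (simp add: max_insertions_def)
    moreover have "insert_at (us @ vs) (length us, m) = f" by (simp add: insert_at_def split)
    ultimately show "f \<in> (\<lambda>(e, k). insert_at e k) ` (SIGMA e:S n. max_insertions e)"
      by (metis (mono_tags, lifting) case_prod_conv image_eqI)
  qed
qed

lemma card_avoiding_101_102:
  "of_nat (card (inversion_seqs_avoiding n {[1,0,1], [1,0,2]})) = fps_nth A106228_gf n"
proof -
  define A where "A = A106228_gf"
  have cubic: "A = 1 + fps_X * A * ratio A"
    unfolding A_def by (rule A106228_gf_cubic)
  define S where "S n = inversion_seqs_avoiding n {[1,0,1], [1,0,2]}" for n
  define W where "W e = slack_weight A (initial_run e - max_entry e)" for e
  have "of_nat (card (S n)) = fps_nth (W []) n"
  proof (rule generating_tree_count[where K = max_insertions and grow = insert_at])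
    show "S 0 = {[]}"
      unfolding S_def set_eq_iff mem_avoiding_101_102 by (auto simp: avoids_101_102_def)
    show "finite (S n)" for n by (simp only: S_def finite_inversion_seqs_avoiding)
    show "finite (max_insertions e)" if "e \<in> S n" for e n
      using that unfolding S_def mem_avoiding_101_102 by (auto simp: max_insertions_eq(2)[of e n])
    show "bij_betw (\<lambda>(e, k). insert_at e k) (SIGMA e:S n. max_insertions e) (S (Suc n))" for n
      unfolding S_def by (rule bij_betw_insert_max)
    show "W e = 1 + fps_X * (\<Sum>k\<in>max_insertions e. W (insert_at e k))" if "e \<in> S n" for e n
    proof -
      define M where "M = max_entry e"
      define l where "l = initial_run e"
      have e: "e \<in> inversion_seqs n" "avoids_101_102 e"
        using that by (simp_all only: S_def mem_avoiding_101_102)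
      note K = max_insertions_eq[OF e, folded M_def l_def]
      have "(\<Sum>k\<in>max_insertions e. W (insert_at e k))
          = (\<Sum>(p, m)\<in>max_insertions e. slack_weight A (Suc p - m))"
        by (rule sum.cong) (auto simp: W_def max_insertion_stats)
      also have "\<dots> = slack_weight A (Suc l - M)
          + (\<Sum>p\<in>{M<..l}. \<Sum>m\<in>{M<..p}. slack_weight A (Suc p - m))"
        unfolding K(2) by (simp add: sum.Sigma)
      also have "(\<Sum>p\<in>{M<..l}. \<Sum>m\<in>{M<..p}. slack_weight A (Suc p - m))
          = (\<Sum>p\<in>{M<..l}. \<Sum>j=1..p - M. slack_weight A j)"
        by (simp only: sum_gap_reindex)
      also have "\<dots> = (\<Sum>q=1..l - M. \<Sum>j=1..q. slack_weight A j)"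
        by (rule sum.reindex_bij_witness[of _ "\<lambda>q. M + q" "\<lambda>p. p - M"]) auto
      also have "slack_weight A (Suc l - M) = slack_weight A (Suc (l - M))"
        using K(1) by (simp only: Suc_diff_le)
      finally show ?thesis
        using slack_weight_eq[OF cubic, of "l - M"] by (simp only: W_def M_def l_def)
    qed
  qed
  moreover have "W [] = A" using initial_run_le[of "[]"] by (simp add: W_def)
  ultimately show ?thesis by (simp only: S_def A_def)
qed

theorem corollary6p2:
  fixes n :: nat
  assumes "n \<ge> 1"
  shows "of_nat (card (inversion_seqs_avoiding n {[1,0,1], [0,2,1]})) = fps_nth A106228_gf n
       \<and> card (inversion_seqs_avoiding n {[1,0,1], [1,0,2]})
         = card (inversion_seqs_avoiding n {[1,0,1], [0,2,1]})"
  using card_avoiding_101_021[of n] card_avoiding_101_102[of n] by (metis of_nat_eq_iff)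

end
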